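(* For every $d\geq3$, the form $$G_d=\sum_{i=0}^{d-1}v_iu_0^iu_1^{d-1-i}$$ of degree $d$ in the $d+2$ variables $v_0,\dots,v_{d-1},u_0,u_1$ over $\mathbb C$ has minimal border rank, i.e. $\underline{\mathbf r}(G_d)=d+2$.
   Context: For a nonzero form $F$ of degree $d$ in $n+1$ variables over $\mathbb C$, the border rank $\underline{\mathbf r}(F)$ is the least $r$ with $[F]\in\sigma_r(X)$, where $X=\nu_d(\mathbb P^n)$ is the Veronese variety of $d$-th powers $[L^d]$ of linear forms and $\sigma_r(X)$ is its $r$-th secant variety (closure of the union of the spans of $r$ points of $X$). *)

theory Defs
  imports Complex_Main "HOL-Library.FuncSet" "HOL-Library.Poly_Mapping"
begin

text \<open>
  Monomials in variables of type \<^typ>\<open>'v\<close> are finitely supported exponent vectors, and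
  polynomials are finitely supported families of coefficients indexed by monomials, with the
  convolution product of \<^theory>\<open>HOL-Library.Poly_Mapping\<close>.
\<close>

type_synonym 'v monomial = "'v \<Rightarrow>\<^sub>0 nat"
type_synonym 'v cpoly = "'v monomial \<Rightarrow>\<^sub>0 complex"

definition var :: "'v \<Rightarrow> 'v cpoly" where
  "var x = Poly_Mapping.single (Poly_Mapping.single x 1) 1"

definition eval_cpoly :: "('v \<Rightarrow> complex) \<Rightarrow> 'v cpoly \<Rightarrow> complex" where
  "eval_cpoly a P =
     (\<Sum>m\<in>Poly_Mapping.keys P. Poly_Mapping.lookup P m *
        (\<Prod>x\<in>Poly_Mapping.keys m. a x ^ Poly_Mapping.lookup m x))"

definition monomials :: "'v set \<Rightarrow> nat \<Rightarrow> 'v monomial set" where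
  "monomials A d =
     {m. Poly_Mapping.keys m \<subseteq> A \<and> (\<Sum>x\<in>Poly_Mapping.keys m. Poly_Mapping.lookup m x) = d}"

text \<open>The vector space of forms of degree \<open>d\<close> in the variables \<open>A\<close>, including 0.\<close>

definition forms :: "'v set \<Rightarrow> nat \<Rightarrow> 'v cpoly set" where
  "forms A d = {F. Poly_Mapping.keys F \<subseteq> monomials A d}"

definition cscale :: "complex \<Rightarrow> 'v cpoly \<Rightarrow> 'v cpoly" where
  "cscale c F = Poly_Mapping.map ((*) c) F"

lemma cscale_conv_mult: "cscale c F = Poly_Mapping.single 0 c * F"
  unfolding cscale_def by (rule mult_map_scale_conv_mult)

lemma lookup_cscale: "Poly_Mapping.lookup (cscale c F) m = c * Poly_Mapping.lookup F m"
  unfolding cscale_def by (simp add: map.rep_eq when_def)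

global_interpretation cpoly: vector_space cscale
  by unfold_locales (auto intro!: poly_mapping_eqI simp: lookup_cscale lookup_add algebra_simps)

text \<open>
  The point \<open>[F]\<close> is represented by the set of all its homogeneous coordinate vectors;
  \<open>proj W\<close> is the set of points of \<open>\<P>(W)\<close>.
\<close>

definition proj_pt :: "'v cpoly \<Rightarrow> 'v cpoly set" where
  "proj_pt F = {cscale c F | c. c \<noteq> 0}"

definition proj :: "'v cpoly set \<Rightarrow> 'v cpoly set set" where
  "proj W = proj_pt ` (W - {0})"

text \<open>
  Zariski topology on the projective space of forms of degree \<open>d\<close> in the variables \<open>A\<close>.
  The homogeneous coordinates of \<open>[F]\<close> are the coefficients of \<open>F\<close>, so the defining equations are
  forms (of any degree \<open>e\<close>) in coordinate variables that are themselves indexed by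
  \<^term>\<open>monomials A d\<close>.
\<close>

definition zariski_closed :: "'v set \<Rightarrow> nat \<Rightarrow> 'v cpoly set set \<Rightarrow> bool" where
  "zariski_closed A d Z \<longleftrightarrow>
     (\<exists>E \<subseteq> (\<Union>e. forms (monomials A d) e).
        Z = proj {F \<in> forms A d. \<forall>P\<in>E. eval_cpoly (Poly_Mapping.lookup F) P = 0})"

definition veronese :: "'v set \<Rightarrow> nat \<Rightarrow> 'v cpoly set set" where
  "veronese A d = {proj_pt (L ^ d) | L. L \<in> forms A 1 \<and> L \<noteq> 0}"

text \<open>Since points are sets of representatives, \<^term>\<open>\<Union>S\<close> is the set of all representatives of
  points in \<open>S\<close>.\<close>

definition proj_span :: "'v cpoly set set \<Rightarrow> 'v cpoly set set" where
  "proj_span S = proj (cpoly.span (\<Union>S))"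

text \<open>The \<open>r\<close> points need not be distinct.\<close>

definition secant_variety :: "'v set \<Rightarrow> nat \<Rightarrow> nat \<Rightarrow> 'v cpoly set set" where
  "secant_variety A d r =
     zariski_closed A d hull (\<Union>p \<in> {..<r} \<rightarrow> veronese A d. proj_span (p ` {..<r}))"

text \<open>Meaningful for a nonempty finite \<open>A\<close> and a nonzero \<^term>\<open>F \<in> forms A d\<close>.\<close>

definition border_rank :: "'v set \<Rightarrow> nat \<Rightarrow> 'v cpoly \<Rightarrow> nat" where
  "border_rank A d F = (LEAST r. proj_pt F \<in> secant_variety A d r)"

datatype gvar = V nat | U nat

definition G_vars :: "nat \<Rightarrow> gvar set" where
  "G_vars d = V ` {..<d} \<union> {U 0, U 1}"

definition G :: "nat \<Rightarrow> gvar cpoly" where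
  "G d = (\<Sum>i<d. var (V i) * var (U 0) ^ i * var (U 1) ^ (d - 1 - i))"

lemma card_G_vars: "card (G_vars d) = d + 2"
proof -
  have "card (V ` {..<d}) = d" by (simp add: card_image inj_on_def)
  moreover have "card (V ` {..<d} \<union> {U 0, U 1}) = card (V ` {..<d}) + card {U 0, U 1}"
    by (rule card_Un_disjoint) auto
  ultimately show ?thesis by (simp add: G_vars_def)
qed

lemma var_power: "var x ^ n = Poly_Mapping.single (Poly_Mapping.single x n) 1"
proof (induction n)
  case (Suc n)
  then show ?case
    by (simp add: var_def mult_single flip: single_add)
qed simp

lemma G_eq:
  "G d = (\<Sum>i<d. Poly_Mapping.single
     (Poly_Mapping.single (V i) 1 + Poly_Mapping.single (U 0) i +
      Poly_Mapping.single (U 1) (d - 1 - i)) 1)"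
  unfolding G_def var_power by (simp only: var_def mult_single mult_1_left)

lemma G_in_forms: "G d \<in> forms (G_vars d) d"
proof -
  let ?m = "\<lambda>i. Poly_Mapping.single (V i) 1 + Poly_Mapping.single (U 0) i +
      Poly_Mapping.single (U 1) (d - 1 - i)"
  have mon: "?m i \<in> monomials (G_vars d) d" if "i < d" for i
  proof -
    have sub: "Poly_Mapping.keys (?m i) \<subseteq> {V i, U 0, U 1}"
    proof
      fix x assume "x \<in> Poly_Mapping.keys (?m i)"
      then show "x \<in> {V i, U 0, U 1}"
        by (cases "x \<in> {V i, U 0, U 1}") (auto simp: in_keys_iff lookup_add lookup_single)
    qed
    have "(\<Sum>x\<in>Poly_Mapping.keys (?m i). Poly_Mapping.lookup (?m i) x) =
        (\<Sum>x\<in>{V i, U 0, U 1}. Poly_Mapping.lookup (?m i) x)"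
      by (rule sum.mono_neutral_left) (use sub in \<open>auto simp: in_keys_iff\<close>)
    also have "\<dots> = d"
      using that by (simp add: lookup_add lookup_single when_def)
    finally show ?thesis
      using sub that by (auto simp: monomials_def G_vars_def)
  qed
  have "Poly_Mapping.keys (G d) \<subseteq> ?m ` {..<d}"
  proof
    fix k assume "k \<in> Poly_Mapping.keys (G d)"
    then have "(\<Sum>i<d. 1 when ?m i = k) \<noteq> (0 :: complex)"
      by (simp add: in_keys_iff G_eq lookup_sum lookup_single)
    then obtain i where "i < d" "?m i = k"
      by (rule sum.not_neutral_contains_not_neutral) (auto simp: when_def split: if_splits)
    then show "k \<in> ?m ` {..<d}" by blast
  qed
  then show ?thesis
    using mon by (auto simp: forms_def)
qed

lemma G_nonzero:
  assumes "d > 0"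
  shows "G d \<noteq> 0"
proof -
  let ?m = "\<lambda>i. Poly_Mapping.single (V i) 1 + Poly_Mapping.single (U 0) i +
      Poly_Mapping.single (U 1) (d - 1 - i)"
  have "?m i = ?m 0 \<longleftrightarrow> i = 0" for i
  proof
    assume "?m i = ?m 0"
    then have "Poly_Mapping.lookup (?m i) (V 0) = Poly_Mapping.lookup (?m 0) (V 0)"
      by (rule arg_cong)
    then show "i = 0"
      by (simp add: lookup_add lookup_single when_def split: if_splits)
  qed simp
  then have "Poly_Mapping.lookup (G d) (?m 0) = (\<Sum>i<d. 1 when i = 0)"
    by (simp only: G_eq lookup_sum lookup_single)
  also have "\<dots> = 1"
    using assms by (simp add: when_def)
  finally show ?thesis by auto
qed

end

theory Submission
  imports Defs "Jordan_Normal_Form.Determinant"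
begin

text \<open>
  Upper bound: let \<open>z\<close> be a primitive \<open>d\<close>-th root of unity and \<open>L\<^sub>j = z\<^sup>j u\<^sub>0 + u\<^sub>1\<close> for \<open>j < d\<close>.
  The powers of the \<open>L\<^sub>j\<close> with exponent \<open>d - 1\<close> form a basis of the binary forms, so
  \<open>G = \<Sum>\<^sub>j w\<^sub>j L\<^sub>j\<^sup>d\<^sup>-\<^sup>1\<close> for suitable linear forms \<open>w\<^sub>j\<close> in the \<open>v\<^sub>i\<close>. Since
  \<open>\<Sum>\<^sub>j L\<^sub>j\<^sup>d = d (u\<^sub>0\<^sup>d + u\<^sub>1\<^sup>d)\<close>, the form \<open>G\<close> is the limit for \<open>t \<longlonglongrightarrow> 0\<close> of
  \<open>(1 / (d t)) (\<Sum>\<^sub>j (L\<^sub>j + t w\<^sub>j)\<^sup>d - d u\<^sub>0\<^sup>d - d u\<^sub>1\<^sup>d)\<close>, a combination of \<open>d + 2\<close> powers.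

  Lower bound: the matrix of first partial derivatives (the first catalecticant) has rank at most
  \<open>r\<close> on a sum of \<open>r\<close> powers, so its minors of size \<open>d + 2\<close> vanish on the secant varieties of
  smaller index, whereas a suitable minor of \<open>G\<close> is diagonal with nonzero entries.
\<close>

section \<open>Graded pieces of the polynomial ring\<close>

definition mdeg :: "'v monomial \<Rightarrow> nat" where
  "mdeg m = (\<Sum>x\<in>Poly_Mapping.keys m. Poly_Mapping.lookup m x)"

lemma in_monomials_iff: "m \<in> monomials A d \<longleftrightarrow> Poly_Mapping.keys m \<subseteq> A \<and> mdeg m = d"
  by (simp add: monomials_def mdeg_def)

lemma mdeg_superset:
  assumes "finite S" "Poly_Mapping.keys m \<subseteq> S"
  shows "mdeg m = sum (Poly_Mapping.lookup m) S"
  unfolding mdeg_def using assms by (intro sum.mono_neutral_left) (auto simp: in_keys_iff)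

lemma mdeg_add: "mdeg (m + n) = mdeg m + mdeg n"
proof -
  let ?S = "Poly_Mapping.keys m \<union> Poly_Mapping.keys n"
  have "mdeg (m + n) = sum (Poly_Mapping.lookup (m + n)) ?S"
    by (rule mdeg_superset) (use Poly_Mapping.keys_add[of m n] in auto)
  also have "\<dots> = sum (Poly_Mapping.lookup m) ?S + sum (Poly_Mapping.lookup n) ?S"
    by (simp add: lookup_add sum.distrib)
  also have "\<dots> = mdeg m + mdeg n"
    by (simp add: mdeg_superset[of ?S])
  finally show ?thesis .
qed

lemma mdeg_single [simp]: "mdeg (Poly_Mapping.single x k) = k"
  by (simp add: mdeg_def)

lemma mdeg_zero [simp]: "mdeg 0 = 0"
  by (simp add: mdeg_def)

lemma monomials_add:
  assumes "m \<in> monomials A a" "n \<in> monomials A b"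
  shows "m + n \<in> monomials A (a + b)"
  using assms Poly_Mapping.keys_add[of m n] by (auto simp: in_monomials_iff mdeg_add)

lemma single_in_monomials: "x \<in> A \<Longrightarrow> Poly_Mapping.single x k \<in> monomials A k"
  by (auto simp: in_monomials_iff)

text \<open>Applied below with \<open>A\<close> itself a set of monomials: the sum is then the
  exponent vector of a product of coefficient variables, one factor per row of a minor, with
  repetitions allowed.\<close>

lemma sum_singles_in_monomials:
  assumes "finite I" "\<And>i. i \<in> I \<Longrightarrow> f i \<in> A"
  shows "(\<Sum>i\<in>I. Poly_Mapping.single (f i) 1) \<in> monomials A (card I)"
  using assms
proof (induction I rule: finite_induct)
  case empty
  then show ?case by (simp add: in_monomials_iff)
next
  case (insert i I)
  then show ?case
    using monomials_add[OF single_in_monomials[of "f i" A 1]] by simp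
qed

lemma subspace_forms: "cpoly.subspace (forms A d)"
proof (rule cpoly.subspaceI)
  show "0 \<in> forms A d" by (simp add: forms_def)
next
  fix F K assume "F \<in> forms A d" "K \<in> forms A d"
  then show "F + K \<in> forms A d"
    using Poly_Mapping.keys_add[of F K] by (auto simp: forms_def)
next
  fix c F assume "F \<in> forms A d"
  then show "cscale c F \<in> forms A d"
    by (auto simp: forms_def in_keys_iff lookup_cscale)
qed

lemma single_in_forms: "m \<in> monomials A d \<Longrightarrow> Poly_Mapping.single m c \<in> forms A d"
  by (auto simp: forms_def)

lemma var_in_forms: "x \<in> A \<Longrightarrow> var x \<in> forms A 1"
  unfolding var_def by (intro single_in_forms single_in_monomials)

lemma forms_mult:
  assumes "F \<in> forms A a" "K \<in> forms A b"
  shows "F * K \<in> forms A (a + b)"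
  using assms Poly_Mapping.keys_mult[of F K] monomials_add
  unfolding forms_def by blast

lemma forms_power:
  assumes "L \<in> forms A 1"
  shows "L ^ n \<in> forms A n"
proof (induction n)
  case 0
  then show ?case by (auto simp: forms_def in_monomials_iff)
next
  case (Suc n)
  then show ?case using forms_mult[OF assms Suc] by simp
qed

lemma cscale_mult_left: "cscale c F * K = cscale c (F * K)"
  by (simp add: cscale_conv_mult mult.assoc)

lemma cscale_mult_right: "F * cscale c K = cscale c (F * K)"
  by (simp add: cscale_conv_mult mult.left_commute)

lemma cscale_power: "cscale c F ^ n = cscale (c ^ n) (F ^ n)"
  by (induction n) (simp_all add: cscale_mult_left cscale_mult_right)

lemma of_nat_mult_cpoly: "of_nat n * (F :: 'v cpoly) = cscale (of_nat n) F"
  by (simp add: cscale_conv_mult)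

section \<open>Evaluation of forms and limits in the Zariski closure\<close>

definition eval_monomial :: "('v \<Rightarrow> complex) \<Rightarrow> 'v monomial \<Rightarrow> complex" where
  "eval_monomial a m = (\<Prod>x\<in>Poly_Mapping.keys m. a x ^ Poly_Mapping.lookup m x)"

lemma eval_monomial_superset:
  assumes "finite S" "Poly_Mapping.keys m \<subseteq> S"
  shows "eval_monomial a m = (\<Prod>x\<in>S. a x ^ Poly_Mapping.lookup m x)"
  unfolding eval_monomial_def using assms
  by (intro prod.mono_neutral_left) (auto simp: in_keys_iff)

lemma eval_monomial_add: "eval_monomial a (m + n) = eval_monomial a m * eval_monomial a n"
proof -
  let ?S = "Poly_Mapping.keys m \<union> Poly_Mapping.keys n"
  have "eval_monomial a (m + n) = (\<Prod>x\<in>?S. a x ^ Poly_Mapping.lookup (m + n) x)"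
    by (rule eval_monomial_superset) (use Poly_Mapping.keys_add[of m n] in auto)
  then show ?thesis
    by (simp add: lookup_add power_add prod.distrib eval_monomial_superset[of ?S])
qed

lemma eval_monomial_sum_singles:
  "eval_monomial a (\<Sum>i\<in>I. Poly_Mapping.single (f i) 1) = (\<Prod>i\<in>I. a (f i))"
  by (induction I rule: infinite_finite_induct)
    (simp_all add: eval_monomial_add, simp_all add: eval_monomial_def)

lemma eval_monomial_scale: "eval_monomial (\<lambda>x. c * a x) m = c ^ mdeg m * eval_monomial a m"
  by (simp add: eval_monomial_def mdeg_def power_mult_distrib prod.distrib power_sum)

lemma eval_cpoly_superset:
  assumes "finite S" "Poly_Mapping.keys P \<subseteq> S"
  shows "eval_cpoly a P = (\<Sum>m\<in>S. Poly_Mapping.lookup P m * eval_monomial a m)"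
  unfolding eval_cpoly_def eval_monomial_def using assms
  by (intro sum.mono_neutral_left) (auto simp: in_keys_iff)

lemma eval_cpoly_add: "eval_cpoly a (P + Q) = eval_cpoly a P + eval_cpoly a Q"
proof -
  let ?S = "Poly_Mapping.keys P \<union> Poly_Mapping.keys Q"
  have "eval_cpoly a (P + Q) = (\<Sum>m\<in>?S. Poly_Mapping.lookup (P + Q) m * eval_monomial a m)"
    by (rule eval_cpoly_superset) (use Poly_Mapping.keys_add[of P Q] in auto)
  then show ?thesis
    by (simp add: lookup_add ring_distribs sum.distrib eval_cpoly_superset[of ?S])
qed

lemma eval_cpoly_sum: "eval_cpoly a (\<Sum>i\<in>I. P i) = (\<Sum>i\<in>I. eval_cpoly a (P i))"
proof (induction I rule: infinite_finite_induct)
  case (insert i I)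
  then show ?case by (simp add: eval_cpoly_add)
qed (simp_all add: eval_cpoly_def)

lemma eval_cpoly_single: "eval_cpoly a (Poly_Mapping.single m c) = c * eval_monomial a m"
  by (subst eval_cpoly_superset[of "{m}"]) auto

lemma eval_form_scale:
  assumes "P \<in> forms A e"
  shows "eval_cpoly (\<lambda>x. c * a x) P = c ^ e * eval_cpoly a P"
proof -
  have "eval_cpoly (\<lambda>x. c * a x) P = (\<Sum>m\<in>Poly_Mapping.keys P.
      Poly_Mapping.lookup P m * (c ^ mdeg m * eval_monomial a m))"
    by (simp add: eval_cpoly_superset[of "Poly_Mapping.keys P"] eval_monomial_scale)
  also have "\<dots> = (\<Sum>m\<in>Poly_Mapping.keys P. c ^ e * (Poly_Mapping.lookup P m * eval_monomial a m))"
    using assms by (intro sum.cong) (auto simp: forms_def in_monomials_iff)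
  also have "\<dots> = c ^ e * eval_cpoly a P"
    by (simp add: eval_cpoly_superset[of "Poly_Mapping.keys P"] sum_distrib_left)
  finally show ?thesis .
qed

lemma isCont_eval_cpoly:
  assumes "\<And>x. isCont (\<lambda>t. a t x) s"
  shows "isCont (\<lambda>t. eval_cpoly (a t) P) s"
  unfolding eval_cpoly_def using assms by (intro continuous_intros)

lemma proj_pt_self: "F \<in> proj_pt F"
  unfolding proj_pt_def by (rule CollectI, rule exI[of _ 1]) simp

text \<open>The equations in \<open>E\<close> are homogeneous, so passing to a nonzero multiple only
  multiplies their values by a power of the scalar. Membership of a point can therefore be tested on
  any representative.\<close>

lemma proj_pt_in_proj_iff:
  assumes E: "E \<subseteq> (\<Union>e. forms (monomials A d) e)"
  shows "proj_pt F \<in> proj {F \<in> forms A d. \<forall>P\<in>E. eval_cpoly (Poly_Mapping.lookup F) P = 0} \<longleftrightarrow>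
    F \<noteq> 0 \<and> F \<in> forms A d \<and> (\<forall>P\<in>E. eval_cpoly (Poly_Mapping.lookup F) P = 0)"
    (is "?l \<longleftrightarrow> ?r")
proof
  assume ?l
  then obtain K where K: "K \<noteq> 0" "K \<in> forms A d"
      "\<forall>P\<in>E. eval_cpoly (Poly_Mapping.lookup K) P = 0" and FK: "proj_pt F = proj_pt K"
    by (auto simp: proj_def)
  have "F \<in> proj_pt K"
    using proj_pt_self[of F] FK by simp
  then obtain c where c: "c \<noteq> 0" "F = cscale c K"
    unfolding proj_pt_def by blast
  have "eval_cpoly (Poly_Mapping.lookup F) P = 0" if P: "P \<in> E" for P
  proof -
    obtain e where "P \<in> forms (monomials A d) e" using E P by blast
    then show ?thesis
      using eval_form_scale[of P _ e c "Poly_Mapping.lookup K"] K(3) P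
      by (simp add: c(2) lookup_cscale[abs_def])
  qed
  moreover have "F \<in> forms A d"
    unfolding c(2) by (rule cpoly.subspace_scale[OF subspace_forms K(2)])
  ultimately show ?r using c K(1) by simp
qed (auto simp: proj_def)

text \<open>Polynomial equations are continuous in the coefficients, so every Zariski closed set
  containing \<open>S\<close> also contains limits of points of \<open>S\<close> in the classical
  topology. This gives membership in the closure without exhibiting its equations.\<close>

lemma limit_in_zariski_hull:
  fixes F :: "complex \<Rightarrow> 'v cpoly"
  assumes cont: "\<And>m. isCont (\<lambda>t. Poly_Mapping.lookup (F t) m) 0"
    and F0: "F 0 \<noteq> 0" "F 0 \<in> forms A d"
    and S: "\<And>t. t \<noteq> 0 \<Longrightarrow> F t \<noteq> 0 \<Longrightarrow> proj_pt (F t) \<in> S"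
  shows "proj_pt (F 0) \<in> zariski_closed A d hull S"
  unfolding hull_def
proof (intro InterI, elim CollectE conjE)
  fix Z assume Z: "zariski_closed A d Z" and SZ: "S \<subseteq> Z"
  then obtain E where E: "E \<subseteq> (\<Union>e. forms (monomials A d) e)" and
    ZE: "Z = proj {F \<in> forms A d. \<forall>P\<in>E. eval_cpoly (Poly_Mapping.lookup F) P = 0}"
    unfolding zariski_closed_def by blast
  \<comment> \<open>A coefficient that is nonzero at 0 stays nonzero nearby, so \<open>F t\<close>
    represents a point of \<open>S\<close> for all small nonzero \<open>t\<close>.\<close>
  obtain m where "Poly_Mapping.lookup (F 0) m \<noteq> 0"
    using F0(1) by (metis lookup_zero poly_mapping_eqI)
  then have "\<forall>\<^sub>F t in at 0. Poly_Mapping.lookup (F t) m \<noteq> 0"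
    using cont[of m] by (intro tendsto_imp_eventually_ne[of _ "Poly_Mapping.lookup (F 0) m"])
      (simp_all add: isCont_def)
  then have nz: "\<forall>\<^sub>F t in at 0. t \<noteq> 0 \<and> F t \<noteq> 0"
    using eventually_neq_at_within[of 0 0 UNIV] by eventually_elim auto
  have "eval_cpoly (Poly_Mapping.lookup (F 0)) P = 0" if "P \<in> E" for P
  proof -
    have "\<forall>\<^sub>F t in at 0. eval_cpoly (Poly_Mapping.lookup (F t)) P = 0"
      using nz
    proof eventually_elim
      case (elim t)
      then show ?case
        using S[of t] SZ that proj_pt_in_proj_iff[OF E, of "F t"] unfolding ZE by blast
    qed
    then have "((\<lambda>t. eval_cpoly (Poly_Mapping.lookup (F t)) P) \<longlongrightarrow> 0) (at 0)"
      by (rule tendsto_eventually)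
    moreover have "((\<lambda>t. eval_cpoly (Poly_Mapping.lookup (F t)) P) \<longlongrightarrow>
        eval_cpoly (Poly_Mapping.lookup (F 0)) P) (at 0)"
      using isCont_eval_cpoly[where a = "\<lambda>t. Poly_Mapping.lookup (F t)" and s = 0 and P = P] cont by (simp add: isCont_def)
    ultimately show ?thesis
      using LIM_unique by blast
  qed
  then show "proj_pt (F 0) \<in> Z"
    unfolding ZE proj_pt_in_proj_iff[OF E] using F0 by blast
qed

section \<open>Partial derivatives\<close>

text \<open>Defined through coefficients, so that each entry of a catalecticant is visibly an
  integer multiple of one coefficient of \<open>F\<close>. The product rule is then a lemma.\<close>

definition pdiff :: "'v \<Rightarrow> 'v cpoly \<Rightarrow> 'v cpoly" where
  "pdiff x F = Abs_poly_mapping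
     (\<lambda>m. of_nat (Poly_Mapping.lookup m x + 1) * Poly_Mapping.lookup F (m + Poly_Mapping.single x 1))"

lemma lookup_pdiff:
  "Poly_Mapping.lookup (pdiff x F) m =
    of_nat (Poly_Mapping.lookup m x + 1) * Poly_Mapping.lookup F (m + Poly_Mapping.single x 1)"
proof -
  have "finite ((\<lambda>m. m + Poly_Mapping.single x 1) -` Poly_Mapping.keys F)"
    by (intro finite_vimageI) (auto intro: injI)
  then have "finite {m. of_nat (Poly_Mapping.lookup m x + 1) *
      Poly_Mapping.lookup F (m + Poly_Mapping.single x 1) \<noteq> 0}"
    by (rule rev_finite_subset) (auto simp: in_keys_iff)
  then show ?thesis
    unfolding pdiff_def by (subst lookup_Abs_poly_mapping) auto
qed

lemma pdiff_add: "pdiff x (F + K) = pdiff x F + pdiff x K"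
  by (rule poly_mapping_eqI) (simp add: lookup_pdiff lookup_add ring_distribs)

lemma pdiff_zero [simp]: "pdiff x 0 = 0"
  by (rule poly_mapping_eqI) (simp add: lookup_pdiff)

lemma pdiff_cscale: "pdiff x (cscale c F) = cscale c (pdiff x F)"
  by (rule poly_mapping_eqI) (simp add: lookup_pdiff lookup_cscale)

lemma pdiff_sum: "pdiff x (\<Sum>i\<in>I. F i) = (\<Sum>i\<in>I. pdiff x (F i))"
  by (induction I rule: infinite_finite_induct) (simp_all add: pdiff_add)

text \<open>If \<open>x\<close> does not occur in \<open>m\<close>, the exponent vector on the right is junk, but its coefficient
  is 0.\<close>

lemma pdiff_single:
  "pdiff x (Poly_Mapping.single m c) =
    Poly_Mapping.single (m - Poly_Mapping.single x 1) (of_nat (Poly_Mapping.lookup m x) * c)"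
proof (rule poly_mapping_eqI)
  fix n
  show "Poly_Mapping.lookup (pdiff x (Poly_Mapping.single m c)) n = Poly_Mapping.lookup
    (Poly_Mapping.single (m - Poly_Mapping.single x 1) (of_nat (Poly_Mapping.lookup m x) * c)) n"
  proof (cases "Poly_Mapping.lookup m x = 0")
    case True
    then have "m \<noteq> n + Poly_Mapping.single x 1"
      by (auto simp: lookup_add)
    then show ?thesis
      using True by (simp add: lookup_pdiff lookup_single)
  next
    case False
    then have "m = m - Poly_Mapping.single x 1 + Poly_Mapping.single x 1"
      by (intro poly_mapping_eqI) (auto simp: lookup_add lookup_minus lookup_single when_def)
    then have "m = n + Poly_Mapping.single x 1 \<longleftrightarrow> m - Poly_Mapping.single x 1 = n"
      by (metis add_diff_cancel_right')
    moreover have "of_nat (Poly_Mapping.lookup n x + 1) * c = of_nat (Poly_Mapping.lookup m x) * c"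
      if "m = n + Poly_Mapping.single x 1"
      unfolding that by (simp add: lookup_add)
    ultimately show ?thesis
      by (auto simp: lookup_pdiff lookup_single when_def)
  qed
qed

text \<open>Adding a term instead of overwriting a coefficient suits additive maps such as
  \<open>pdiff\<close>; the two agree because the new exponent vector lies outside the
  support.\<close>

lemma cpoly_induct [case_names zero add]:
  fixes F :: "'v cpoly"
  assumes "Q 0" "\<And>m c F. Q F \<Longrightarrow> Q (Poly_Mapping.single m c + F)"
  shows "Q F"
proof (induction F rule: update_induct)
  case (update F m c)
  then have "Poly_Mapping.update m c F = Poly_Mapping.single m c + F"
    by (intro poly_mapping_eqI)
      (auto simp: lookup_update lookup_add lookup_single when_def in_keys_iff)
  then show ?case using assms(2)[OF update(3)] by simp
qed (fact assms(1))

text \<open>Both sides are additive in \<open>F\<close> and in \<open>K\<close>, which leaves the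
  product of two single terms.\<close>

lemma pdiff_mult: "pdiff x (F * K) = pdiff x F * K + F * pdiff x K"
proof (induction F rule: cpoly_induct)
  case (add m c F)
  have "pdiff x (Poly_Mapping.single m c * K) =
    pdiff x (Poly_Mapping.single m c) * K + Poly_Mapping.single m c * pdiff x K"
  proof (induction K rule: cpoly_induct)
    case (add n b K)
    \<comment> \<open>Subtraction of exponents is truncated, so it commutes with adding
      \<open>q\<close> only if \<open>x\<close> occurs in \<open>p\<close>. Otherwise the
      coefficient is 0 and both terms vanish.\<close>
    have shift: "Poly_Mapping.single (p - Poly_Mapping.single x 1 + q)
          (of_nat (Poly_Mapping.lookup p x) * a) =
        Poly_Mapping.single (p + q - Poly_Mapping.single x 1) (of_nat (Poly_Mapping.lookup p x) * a)"
      for p q :: "'a monomial" and a :: complex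
    proof (cases "Poly_Mapping.lookup p x = 0")
      case False
      then have "p - Poly_Mapping.single x 1 + q = p + q - Poly_Mapping.single x 1"
        by (intro poly_mapping_eqI) (auto simp: lookup_add lookup_minus lookup_single when_def)
      then show ?thesis by simp
    qed simp
    have "pdiff x (Poly_Mapping.single m c * Poly_Mapping.single n b) =
      pdiff x (Poly_Mapping.single m c) * Poly_Mapping.single n b +
      Poly_Mapping.single m c * pdiff x (Poly_Mapping.single n b)"
      using shift[of m n "c * b"] shift[of n m "c * b"]
      by (simp add: mult_single pdiff_single lookup_add ring_distribs single_add ac_simps)
    then show ?case
      using add by (simp add: ring_distribs pdiff_add)
  qed simp
  then show ?case
    using add by (simp add: ring_distribs pdiff_add)
qed simp

lemma pdiff_power: "pdiff x (F ^ Suc n) = of_nat (Suc n) * F ^ n * pdiff x F"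
  by (induction n) (simp_all add: pdiff_mult algebra_simps)

lemma pdiff_linear:
  assumes "L \<in> forms A 1"
  shows "pdiff x L = Poly_Mapping.single 0 (Poly_Mapping.lookup L (Poly_Mapping.single x 1))"
proof (rule poly_mapping_eqI)
  fix m
  have "m = 0" if "Poly_Mapping.lookup L (m + Poly_Mapping.single x 1) \<noteq> 0"
  proof -
    have "m + Poly_Mapping.single x 1 \<in> monomials A 1"
      using that assms by (auto simp: forms_def in_keys_iff)
    then have "mdeg m = 0"
      by (simp add: in_monomials_iff mdeg_add)
    then show ?thesis
      by (intro poly_mapping_eqI) (auto simp: mdeg_def in_keys_iff)
  qed
  then show "Poly_Mapping.lookup (pdiff x L) m = Poly_Mapping.lookup
      (Poly_Mapping.single 0 (Poly_Mapping.lookup L (Poly_Mapping.single x 1))) m"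
    by (auto simp: lookup_pdiff lookup_single when_def)
qed

text \<open>All first derivatives of a power are multiples of one and the same form, so a power has
  a catalecticant of rank at most one. For \<open>d = 0\<close> the factor \<open>of_nat d\<close>
  kills the right-hand side.\<close>

lemma pdiff_linear_power:
  fixes L :: "'v cpoly"
  assumes "L \<in> forms A 1"
  shows "pdiff x (L ^ d) =
    cscale (of_nat d * Poly_Mapping.lookup L (Poly_Mapping.single x 1)) (L ^ (d - 1))"
proof (cases d)
  case 0
  then show ?thesis
    using pdiff_single[of x 0 1] by simp
next
  case (Suc n)
  have "cscale (of_nat (Suc n) * a) K = of_nat (Suc n) * K * Poly_Mapping.single 0 a"
    for a and K :: "'v cpoly"
    using cpoly.scale_scale[of "of_nat (Suc n)" a K]
    by (simp only: of_nat_mult_cpoly cscale_conv_mult mult.assoc mult.commute[of K])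
  then show ?thesis
    unfolding Suc pdiff_power pdiff_linear[OF assms] by (simp only: diff_Suc_1)
qed


section \<open>Catalecticant minors\<close>

text \<open>The matrix factors through dimension \<open>r\<close>. Padding \<open>B\<close> with
  zero columns turns this into a product of square matrices; rows of \<open>C\<close> from
  \<open>r\<close> on are arbitrary, since they only meet those zero columns.\<close>

lemma det_product_rank_deficient:
  fixes B C :: "nat \<Rightarrow> nat \<Rightarrow> 'a :: comm_ring_1"
  assumes "r < N"
  shows "det (mat N N (\<lambda>(i, j). \<Sum>k<r. B i k * C k j)) = 0"
proof -
  let ?B = "mat N N (\<lambda>(i, k). if k < r then B i k else 0)" and ?C = "mat N N (\<lambda>(k, j). C k j)"
  have eq: "mat N N (\<lambda>(i, j). \<Sum>k<r. B i k * C k j) = ?B * ?C"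
  proof (rule eq_matI)
    fix i j assume "i < dim_row (?B * ?C)" "j < dim_col (?B * ?C)"
    then have ij: "i < N" "j < N" by auto
    have "(\<Sum>k<r. B i k * C k j) = (\<Sum>k<N. (if k < r then B i k else 0) * C k j)"
      using assms by (intro sum.mono_neutral_cong_left) auto
    then show "mat N N (\<lambda>(i, j). \<Sum>k<r. B i k * C k j) $$ (i, j) = (?B * ?C) $$ (i, j)"
      using ij by (simp add: scalar_prod_def atLeast0LessThan)
  qed auto
  have "det ?B = 0"
  proof -
    have "(\<Prod>i = 0..<N. ?B $$ (i, p i)) = 0" if p: "p permutes {0..<N}" for p
    proof -
      \<comment> \<open>Column \<open>r\<close> of the padded matrix is zero, and every permutation
        selects an entry in it.\<close>
      obtain i where i: "p i = r" "i \<in> {0..<N}"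
        using assms permutes_image[OF p] by (metis atLeastLessThan_iff image_iff zero_le)
      then have "?B $$ (i, p i) = 0"
        using assms by simp
      then show ?thesis
        using i(2) by (intro prod_zero) auto
    qed
    then show ?thesis
      by (subst det_def'[of _ N]) (auto intro!: sum.neutral)
  qed
  then show ?thesis
    unfolding eq by (subst det_mult[of _ N]) auto
qed

text \<open>A square selection from the first catalecticant: \<open>x\<close> picks the rows and
  \<open>\<mu>\<close> the columns, possibly with repetition.\<close>

definition catalecticant ::
    "nat \<Rightarrow> (nat \<Rightarrow> 'v) \<Rightarrow> (nat \<Rightarrow> 'v monomial) \<Rightarrow> 'v cpoly \<Rightarrow> complex mat" where
  "catalecticant N x \<mu> F = mat N N (\<lambda>(i, j). Poly_Mapping.lookup (pdiff (x i) F) (\<mu> j))"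

text \<open>The Leibniz expansion of the minor, as a form in the coefficients of \<open>F\<close>.\<close>

definition catalecticant_minor ::
    "nat \<Rightarrow> (nat \<Rightarrow> 'v) \<Rightarrow> (nat \<Rightarrow> 'v monomial) \<Rightarrow> 'v monomial cpoly" where
  "catalecticant_minor N x \<mu> = (\<Sum>p | p permutes {0..<N}.
     Poly_Mapping.single (\<Sum>i<N. Poly_Mapping.single (\<mu> (p i) + Poly_Mapping.single (x i) 1) 1)
       (signof p * (\<Prod>i<N. of_nat (Poly_Mapping.lookup (\<mu> (p i)) (x i) + 1))))"

lemma eval_catalecticant_minor:
  "eval_cpoly (Poly_Mapping.lookup F) (catalecticant_minor N x \<mu>) = det (catalecticant N x \<mu> F)"
proof -
  have key: "signof p * (\<Prod>i<N. of_nat (Poly_Mapping.lookup (\<mu> (p i)) (x i) + 1)) *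
      (\<Prod>i<N. Poly_Mapping.lookup F (\<mu> (p i) + Poly_Mapping.single (x i) 1)) =
    signof p * (\<Prod>i = 0..<N. catalecticant N x \<mu> F $$ (i, p i))"
    if p: "p permutes {0..<N}" for p
  proof -
    have "p i < N" if "i < N" for i
      using permutes_in_image[OF p, of i] that by simp
    then show ?thesis
      by (simp add: catalecticant_def lookup_pdiff atLeast0LessThan prod.distrib)
  qed
  have carrier: "catalecticant N x \<mu> F \<in> carrier_mat N N"
    by (simp add: catalecticant_def)
  show ?thesis
    unfolding catalecticant_minor_def eval_cpoly_sum eval_cpoly_single eval_monomial_sum_singles det_def'[OF carrier]
    by (intro sum.cong refl key) simp
qed

text \<open>Homogeneity makes the minor an admissible equation in \<open>zariski_closed\<close>.
  Positivity of \<open>d\<close> ensures that \<open>d - 1\<close> plus one is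
  \<open>d\<close>.\<close>

lemma catalecticant_minor_in_forms:
  assumes "d > 0" "\<And>i. i < N \<Longrightarrow> x i \<in> A" "\<And>j. j < N \<Longrightarrow> \<mu> j \<in> monomials A (d - 1)"
  shows "catalecticant_minor N x \<mu> \<in> forms (monomials A d) N"
  unfolding catalecticant_minor_def
proof (intro cpoly.subspace_sum[OF subspace_forms] single_in_forms)
  fix p assume "p \<in> {p. p permutes {0..<N}}"
  then have p: "p i < N" if "i < N" for i
    using permutes_in_image[of p "{0..<N}" i] that by simp
  have "\<mu> (p i) + Poly_Mapping.single (x i) 1 \<in> monomials A d" if "i < N" for i
    using monomials_add[OF assms(3)[OF p[OF that]] single_in_monomials[OF assms(2)[OF that], of 1]]
      assms(1) by simp
  then show "(\<Sum>i<N. Poly_Mapping.single (\<mu> (p i) + Poly_Mapping.single (x i) 1) 1)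
      \<in> monomials (monomials A d) N"
    using sum_singles_in_monomials[of "{..<N}"
      "\<lambda>i. \<mu> (p i) + Poly_Mapping.single (x i) 1" "monomials A d"] by simp
qed

text \<open>The points contribute all their representatives to the span; the coefficients
  \<open>c k\<close> absorb the choice among them.\<close>

lemma span_proj_pts:
  assumes "F \<in> cpoly.span (\<Union>k<(r::nat). proj_pt (f k))"
  shows "\<exists>c. F = (\<Sum>k<r. cscale (c k) (f k))"
proof -
  let ?W = "{F. \<exists>c. F = (\<Sum>k<r. cscale (c k) (f k))}"
  have "cpoly.subspace ?W"
  proof (rule cpoly.subspaceI)
    show "0 \<in> ?W" by (auto intro: exI[of _ "\<lambda>_. 0"])
  next
    fix F K assume "F \<in> ?W" "K \<in> ?W"
    then obtain c e where "F = (\<Sum>k<r. cscale (c k) (f k))" "K = (\<Sum>k<r. cscale (e k) (f k))"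
      by blast
    then have "F + K = (\<Sum>k<r. cscale (c k + e k) (f k))"
      by (simp add: cpoly.scale_left_distrib sum.distrib)
    then show "F + K \<in> ?W" by (auto intro: exI[of _ "\<lambda>k. c k + e k"])
  next
    fix b F assume "F \<in> ?W"
    then obtain c where "F = (\<Sum>k<r. cscale (c k) (f k))" by blast
    then have "cscale b F = (\<Sum>k<r. cscale (b * c k) (f k))"
      by (simp add: cpoly.scale_sum_right)
    then show "cscale b F \<in> ?W" by (auto intro: exI[of _ "\<lambda>k. b * c k"])
  qed
  moreover have "(\<Union>k<r. proj_pt (f k)) \<subseteq> ?W"
  proof
    fix F assume "F \<in> (\<Union>k<r. proj_pt (f k))"
    then obtain k c where k: "k < r" "F = cscale c (f k)"
      by (auto simp: proj_pt_def)
    have "(\<Sum>l<r. cscale (if l = k then c else 0) (f l)) = (\<Sum>l<r. if l = k then cscale c (f k) else 0)"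
      by (intro sum.cong) auto
    then have "F = (\<Sum>l<r. cscale (if l = k then c else 0) (f l))"
      using k by simp
    then show "F \<in> ?W" by (auto intro: exI[of _ "\<lambda>l. if l = k then c else 0"])
  qed
  ultimately show ?thesis
    using cpoly.span_minimal assms by blast
qed

text \<open>The zero locus of the minor is closed and contains the span of any \<open>r\<close>
  points of the Veronese variety, hence it contains the closure of their union.\<close>

lemma catalecticant_vanishes_on_secant:
  fixes x :: "nat \<Rightarrow> 'v"
  assumes F: "proj_pt F \<in> secant_variety A d r" and "r < N" "d > 0"
    and x: "\<And>i. i < N \<Longrightarrow> x i \<in> A" and \<mu>: "\<And>j. j < N \<Longrightarrow> \<mu> j \<in> monomials A (d - 1)"
  shows "det (catalecticant N x \<mu> F) = 0"
proof -
  let ?E = "{catalecticant_minor N x \<mu>}"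
  let ?Z = "proj {F \<in> forms A d. \<forall>P\<in>?E. eval_cpoly (Poly_Mapping.lookup F) P = 0}"
  have E: "?E \<subseteq> (\<Union>e. forms (monomials A d) e)"
    using catalecticant_minor_in_forms[of d N x A \<mu>] assms by blast
  then have "zariski_closed A d ?Z"
    unfolding zariski_closed_def by blast
  moreover have "proj_span (p ` {..<r}) \<subseteq> ?Z" if p: "p \<in> {..<r} \<rightarrow> veronese A d" for p
  proof -
    have "\<exists>L. p k = proj_pt (L ^ d) \<and> L \<in> forms A 1" if "k < r" for k
      using p that by (force simp: veronese_def)
    then obtain L where pL: "\<And>k. k < r \<Longrightarrow> p k = proj_pt (L k ^ d)"
      and L: "\<And>k. k < r \<Longrightarrow> L k \<in> forms A 1"
      by metis
    have "K \<in> forms A d \<and> eval_cpoly (Poly_Mapping.lookup K) (catalecticant_minor N x \<mu>) = 0"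
      if "K \<in> cpoly.span (\<Union>(p ` {..<r}))" for K
    proof -
      have "(\<Union>(p ` {..<r})) = (\<Union>k<r. proj_pt (L k ^ d))"
        using pL by auto
      then obtain c where K: "K = (\<Sum>k<r. cscale (c k) (L k ^ d))"
        using span_proj_pts[where F = K and r = r and f = "\<lambda>k. L k ^ d"] \<open>K \<in> _\<close> by auto
      \<comment> \<open>Each power contributes a factor depending on the row times a factor
        depending on the column, so the matrix is a sum of \<open>r\<close> matrices of rank at most
        one.\<close>
      have "catalecticant N x \<mu> K = mat N N (\<lambda>(i, j). \<Sum>k<r.
          (c k * of_nat d * Poly_Mapping.lookup (L k) (Poly_Mapping.single (x i) 1)) *
          Poly_Mapping.lookup (L k ^ (d - 1)) (\<mu> j))"
        unfolding catalecticant_def K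
        by (rule cong_mat) (auto simp: pdiff_sum pdiff_cscale lookup_sum lookup_cscale
            pdiff_linear_power[OF L] mult.assoc intro!: sum.cong)
      then have "det (catalecticant N x \<mu> K) = 0"
        using det_product_rank_deficient[OF \<open>r < N\<close>] by simp
      moreover have "K \<in> forms A d"
        unfolding K by (intro cpoly.subspace_sum[OF subspace_forms]
            cpoly.subspace_scale[OF subspace_forms] forms_power) (metis L lessThan_iff)
      ultimately show ?thesis
        by (simp add: eval_catalecticant_minor)
    qed
    then show ?thesis
      unfolding proj_span_def by (auto simp: proj_def)
  qed
  ultimately have "proj_pt F \<in> ?Z"
    using F unfolding secant_variety_def hull_def by blast
  then show ?thesis
    unfolding proj_pt_in_proj_iff[OF E] by (simp add: eval_catalecticant_minor)
qed


section \<open>The form \<open>G\<close>\<close>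

lemma cscale_add_power:
  "(cscale c F + K) ^ n = (\<Sum>k\<le>n. cscale (of_nat (n choose k) * c ^ k) (F ^ k * K ^ (n - k)))"
  unfolding binomial_ring
  by (simp add: cscale_power cscale_mult_left cscale_mult_right of_nat_mult_cpoly mult.assoc)
    (simp only: mult.commute)

lemma lookup_var: "Poly_Mapping.lookup (var x) (Poly_Mapping.single y 1) = (if x = y then 1 else 0)"
proof -
  have "Poly_Mapping.single x (1::nat) = Poly_Mapping.single y 1 \<longleftrightarrow> x = y"
    by (metis lookup_single_eq lookup_single_not_eq zero_neq_one)
  then show ?thesis
    by (simp add: var_def lookup_single when_def)
qed

lemma root_of_unity_power_eq_iff:
  assumes "i < d" "k < d"
  shows "cis (2 * pi / real d) ^ i = cis (2 * pi / real d) ^ k \<longleftrightarrow> i = k"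
proof -
  have eq: "cis (2 * pi / real d) ^ l = cis (2 * pi * real l / real d)" for l
    by (simp add: DeMoivre mult_ac)
  have "inj_on (\<lambda>l. cis (2 * pi * real l / real d)) {..<d}"
    using bij_betw_roots_unity[of d] assms by (simp add: bij_betw_def)
  then show ?thesis
    using assms unfolding eq by (auto simp: inj_on_def)
qed

lemma sum_powers_root_of_unity:
  fixes x :: complex
  assumes "x ^ d = 1"
  shows "(\<Sum>j<d. x ^ j) = (if x = 1 then of_nat d else 0)"
  using assms by (simp add: geometric_sum)

lemma G_in_secant_variety:
  assumes d: "d > 0"
  shows "proj_pt (G d) \<in> secant_variety (G_vars d) d (d + 2)"
proof -
  define z where "z = cis (2 * pi / real d)"
  define L where "L j = cscale (z ^ j) (var (U 0)) + var (U 1)" for j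
  \<comment> \<open>An inverse discrete Fourier transform in \<open>j\<close>: expanding
    \<open>L j ^ (d - 1)\<close> produces \<open>(d - 1) choose i\<close> times
    \<open>(z ^ j) ^ i\<close>, and summing over \<open>j\<close> produces \<open>d\<close>; the
    denominator cancels both constants.\<close>
  define w where "w j = (\<Sum>i<d. cscale (inverse (z ^ j) ^ i / (of_nat d * of_nat ((d - 1) choose i)))
    (var (V i)))" for j
  \<comment> \<open>The difference quotient of the approximating sum after division by
    \<open>t\<close>, written as a polynomial in \<open>t\<close> so that it makes sense at 0. The
    factor \<open>t ^ k / d\<close> is \<open>t ^ Suc k\<close> divided by
    \<open>d * t\<close>.\<close>
  define F where "F t = (\<Sum>k<d. cscale (t ^ k * (of_nat (d choose Suc k) / of_nat d))
    (\<Sum>j<d. w j ^ Suc k * L j ^ (d - Suc k)))" for t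
  have z0: "z \<noteq> 0" and zd: "z ^ d = 1"
    using d by (simp_all add: z_def DeMoivre)
  have zpow: "z ^ i = z ^ k \<longleftrightarrow> i = k" if "i < d" "k < d" for i k
    unfolding z_def using that by (rule root_of_unity_power_eq_iff)
  have sum_z: "(\<Sum>j<d. (z ^ j) ^ k) = (if k = 0 \<or> k = d then of_nat d else 0)" if "k \<le> d" for k
  proof -
    have "(\<Sum>j<d. (z ^ j) ^ k) = (\<Sum>j<d. (z ^ k) ^ j)"
      by (simp add: mult.commute flip: power_mult)
    also have "\<dots> = (if z ^ k = 1 then of_nat d else 0)"
      by (intro sum_powers_root_of_unity) (metis zd power_mult mult.commute power_one)
    also have "z ^ k = 1 \<longleftrightarrow> k = 0 \<or> k = d"
      using zpow[of k 0] zd d that by (cases "k = d") auto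
    finally show ?thesis .
  qed
  \<comment> \<open>Summation over the roots of unity kills the mixed terms. Thus two further powers
    suffice to cancel the part that would blow up as \<open>t\<close> tends to 0.\<close>
  have sum_L: "(\<Sum>j<d. L j ^ d) = cscale (of_nat d) (var (U 0) ^ d) + cscale (of_nat d) (var (U 1) ^ d)"
  proof -
    have "(\<Sum>j<d. L j ^ d) = (\<Sum>k\<le>d. cscale (of_nat (d choose k) * (\<Sum>j<d. (z ^ j) ^ k))
        (var (U 0) ^ k * var (U 1) ^ (d - k)))"
      unfolding L_def cscale_add_power
      by (subst sum.swap) (simp add: cpoly.scale_sum_left sum_distrib_left)
    also have "\<dots> = (\<Sum>k\<in>{0, d}. cscale (of_nat (d choose k) * (\<Sum>j<d. (z ^ j) ^ k))
        (var (U 0) ^ k * var (U 1) ^ (d - k)))"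
      by (intro sum.mono_neutral_right) (auto simp: sum_z)
    also have "\<dots> = cscale (of_nat d) (var (U 0) ^ d) + cscale (of_nat d) (var (U 1) ^ d)"
      using d sum_z[of 0] sum_z[of d] by simp
    finally show ?thesis .
  qed
  have orth: "(\<Sum>j<d. inverse (z ^ j) ^ i * (z ^ j) ^ k) = (if i = k then of_nat d else 0)"
    if "i < d" "k < d" for i k
  proof -
    have "(\<Sum>j<d. inverse (z ^ j) ^ i * (z ^ j) ^ k) = (\<Sum>j<d. (z ^ k / z ^ i) ^ j)"
      by (intro sum.cong refl)
        (simp add: divide_simps z0 power_divide mult.commute flip: power_mult power_add)
    also have "\<dots> = (if z ^ k / z ^ i = 1 then of_nat d else 0)"
    proof (rule sum_powers_root_of_unity)
      have "(z ^ k) ^ d = 1" "(z ^ i) ^ d = 1"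
        by (metis zd power_mult mult.commute power_one)+
      then show "(z ^ k / z ^ i) ^ d = 1"
        by (simp add: power_divide)
    qed
    also have "z ^ k / z ^ i = 1 \<longleftrightarrow> i = k"
      using zpow[OF that] z0 by (auto simp: divide_simps)
    finally show ?thesis .
  qed
  \<comment> \<open>With the sum over \<open>j\<close> moved innermost, orthogonality of the
    characters leaves only \<open>k = i\<close>.\<close>
  have sum_wL: "(\<Sum>j<d. w j * L j ^ (d - 1)) = G d"
  proof -
    let ?b = "\<lambda>k. of_nat ((d - 1) choose k) :: complex"
    let ?T = "\<lambda>j i k. cscale (?b k / (of_nat d * ?b i) * (inverse (z ^ j) ^ i * (z ^ j) ^ k))
      (var (V i) * (var (U 0) ^ k * var (U 1) ^ (d - 1 - k)))"
    have d1: "{..d - 1} = {..<d}" using d by auto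
    have "w j * L j ^ (d - 1) = (\<Sum>i<d. \<Sum>k<d. ?T j i k)" for j
      unfolding w_def L_def cscale_add_power d1 sum_product
      by (intro sum.cong refl) (simp add: cscale_mult_left cscale_mult_right mult_ac)
    then have "(\<Sum>j<d. w j * L j ^ (d - 1)) = (\<Sum>j<d. \<Sum>i<d. \<Sum>k<d. ?T j i k)"
      by (simp only:)
    also have "\<dots> = (\<Sum>i<d. \<Sum>j<d. \<Sum>k<d. ?T j i k)"
      by (rule sum.swap)
    also have "\<dots> = (\<Sum>i<d. \<Sum>k<d. \<Sum>j<d. ?T j i k)"
      by (intro sum.cong refl sum.swap)
    also have "\<dots> = (\<Sum>i<d. \<Sum>k<d.
        cscale (?b k / (of_nat d * ?b i) * (\<Sum>j<d. inverse (z ^ j) ^ i * (z ^ j) ^ k))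
          (var (V i) * (var (U 0) ^ k * var (U 1) ^ (d - 1 - k))))"
      by (simp only: cpoly.scale_sum_left sum_distrib_left)
    also have "\<dots> = (\<Sum>i<d. \<Sum>k<d. if i = k then
        cscale (?b k / (of_nat d * ?b i) * of_nat d)
          (var (V i) * (var (U 0) ^ k * var (U 1) ^ (d - 1 - k))) else 0)"
      by (intro sum.cong refl) (auto simp: orth)
    also have "\<dots> = (\<Sum>i<d. var (V i) * (var (U 0) ^ i * var (U 1) ^ (d - 1 - i)))"
      using d by (intro sum.cong refl) (auto simp: sum.delta)
    finally show ?thesis
      by (simp add: G_def mult.assoc)
  qed
  have F0: "F 0 = G d"
  proof -
    have "F 0 = (\<Sum>k\<in>{0}. cscale (0 ^ k * (of_nat (d choose Suc k) / of_nat d))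
        (\<Sum>j<d. w j ^ Suc k * L j ^ (d - Suc k)))"
      unfolding F_def using d by (intro sum.mono_neutral_right) auto
    then show ?thesis
      using d sum_wL by simp
  qed
  \<comment> \<open>The part of order 0 in \<open>t\<close> is the sum of the
    \<open>L j ^ d\<close>, which the two extra powers remove; the remaining terms are divisible by
    \<open>t\<close>.\<close>
  have Ft: "F t = (\<Sum>j<d. cscale (1 / (of_nat d * t)) ((cscale t (w j) + L j) ^ d)) +
      cscale (- 1 / t) (var (U 0) ^ d) + cscale (- 1 / t) (var (U 1) ^ d)" if t: "t \<noteq> 0" for t
  proof -
    have "(cscale t (w j) + L j) ^ d = L j ^ d + (\<Sum>k<d. cscale (of_nat (d choose Suc k) * t ^ Suc k)
        (w j ^ Suc k * L j ^ (d - Suc k)))" for j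
      unfolding cscale_add_power
      by (simp only: lessThan_Suc_atMost[symmetric] sum.lessThan_Suc_shift) simp
    then have "(\<Sum>j<d. cscale (1 / (of_nat d * t)) ((cscale t (w j) + L j) ^ d)) =
        cscale (1 / (of_nat d * t)) (\<Sum>j<d. L j ^ d) +
        (\<Sum>j<d. \<Sum>k<d. cscale (t ^ k * (of_nat (d choose Suc k) / of_nat d))
          (w j ^ Suc k * L j ^ (d - Suc k)))"
      using t by (simp add: cpoly.scale_right_distrib cpoly.scale_sum_right sum.distrib mult_ac)
    also have "(\<Sum>j<d. \<Sum>k<d. cscale (t ^ k * (of_nat (d choose Suc k) / of_nat d))
          (w j ^ Suc k * L j ^ (d - Suc k))) = F t"
      unfolding F_def cpoly.scale_sum_right by (rule sum.swap)
    finally show ?thesis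
      using t d unfolding sum_L
      by (simp add: cpoly.scale_right_distrib flip: cpoly.scale_left_distrib)
  qed
  have forms1: "var (U 0) \<in> forms (G_vars d) 1" "var (U 1) \<in> forms (G_vars d) 1"
    "i < d \<Longrightarrow> var (V i) \<in> forms (G_vars d) 1" for i
    by (rule var_in_forms, simp add: G_vars_def)+
  note sub = cpoly.subspace_add[OF subspace_forms] cpoly.subspace_scale[OF subspace_forms]
    cpoly.subspace_sum[OF subspace_forms]
  have "proj_pt (F t) \<in> (\<Union>p \<in> {..<d + 2} \<rightarrow> veronese (G_vars d) d. proj_span (p ` {..<d + 2}))"
    if t: "t \<noteq> 0" "F t \<noteq> 0" for t
  proof -
    \<comment> \<open>The \<open>d + 2\<close> linear forms whose powers span a space containing
      \<open>F t\<close>.\<close>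
    define M where "M k = (if k < d then cscale t (w k) + L k else if k = d then var (U 0) else var (U 1))"
      for k
    have "M k \<in> forms (G_vars d) 1" for k
      unfolding M_def L_def w_def by (auto intro!: sub forms1[unfolded One_nat_def])
    moreover have "M k \<noteq> 0" for k
    proof -
      \<comment> \<open>For \<open>k < d\<close> the coefficient of \<open>U 1\<close> comes from
        \<open>L k\<close> alone, since \<open>w k\<close> involves only the variables
        \<open>V i\<close>; hence no choice of \<open>t\<close> makes \<open>M k\<close>
        vanish.\<close>
      have "Poly_Mapping.lookup (M k) (Poly_Mapping.single (if k = d then U 0 else U 1) 1) = 1"
        by (simp add: M_def L_def w_def lookup_add lookup_sum lookup_cscale lookup_var del: One_nat_def)
      then show ?thesis by auto
    qed
    ultimately have "(\<lambda>k. proj_pt (M k ^ d)) \<in> {..<d + 2} \<rightarrow> veronese (G_vars d) d"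
      by (auto simp: veronese_def)
    moreover have "F t \<in> cpoly.span (\<Union>((\<lambda>k. proj_pt (M k ^ d)) ` {..<d + 2}))" (is "_ \<in> ?S")
    proof -
      have base: "M k ^ d \<in> ?S" if "k < d + 2" for k
        using that by (intro cpoly.span_base) (auto intro: proj_pt_self)
      have "(cscale t (w j) + L j) ^ d \<in> ?S" if "j < d" for j
        using base[of j] that by (simp add: M_def)
      moreover have "var (U 0) ^ d \<in> ?S" "var (U 1) ^ d \<in> ?S"
        using base[of d] base[of "d + 1"] by (simp_all add: M_def)
      ultimately show ?thesis
        unfolding Ft[OF t(1)]
        by (intro cpoly.span_add cpoly.span_sum cpoly.span_scale) auto
    qed
    ultimately show ?thesis
      using t(2) by (force simp: proj_span_def proj_def)
  qed
  moreover have "isCont (\<lambda>t. Poly_Mapping.lookup (F t) m) 0" for m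
    unfolding F_def lookup_sum lookup_cscale by (intro continuous_intros)
  ultimately show ?thesis
    using limit_in_zariski_hull[of F "G_vars d" d] G_in_forms[of d] G_nonzero[OF d]
    unfolding secant_variety_def F0 by blast
qed

section \<open>Lower bound: a diagonal catalecticant minor of \<open>G d\<close>\<close>

definition G_monomial :: "nat \<Rightarrow> nat \<Rightarrow> gvar monomial" where
  "G_monomial d i = Poly_Mapping.single (V i) 1 + Poly_Mapping.single (U 0) i +
     Poly_Mapping.single (U 1) (d - 1 - i)"

lemma lookup_G_monomial:
  "Poly_Mapping.lookup (G_monomial d i) x =
    (case x of V j \<Rightarrow> if i = j then 1 else 0 | U j \<Rightarrow> if j = 0 then i else if j = 1 then d - 1 - i else 0)"
  by (cases x) (auto simp: G_monomial_def lookup_add lookup_single when_def)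

lemma lookup_G: "Poly_Mapping.lookup (G d) m = (if \<exists>i<d. m = G_monomial d i then 1 else 0)"
proof -
  have inj: "G_monomial d i = G_monomial d j \<longleftrightarrow> i = j" for i j
    using lookup_G_monomial[of d i "V j"] lookup_G_monomial[of d j "V j"] by (auto split: if_splits)
  have "Poly_Mapping.lookup (G d) m = (\<Sum>i<d. 1 when G_monomial d i = m)"
    by (simp only: G_eq G_monomial_def lookup_sum lookup_single)
  also have "\<dots> = (if \<exists>i<d. m = G_monomial d i then 1 else 0)"
    by (auto simp: inj when_def intro!: sum.neutral)
  finally show ?thesis .
qed

text \<open>Differentiating \<open>G\<close> by \<open>V i\<close> gives the binary monomial with index \<open>i\<close>; the other two columns
  are monomials that occur in exactly one of the derivatives by \<open>U 0\<close> and \<open>U 1\<close>.\<close>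

definition G_row :: "nat \<Rightarrow> nat \<Rightarrow> gvar" where
  "G_row d i = (if i < d then V i else U (i - d))"

definition G_column :: "nat \<Rightarrow> nat \<Rightarrow> gvar monomial" where
  "G_column d j =
    (if j < d then Poly_Mapping.single (U 0) j + Poly_Mapping.single (U 1) (d - 1 - j)
     else if j = d then Poly_Mapping.single (V (d - 1)) 1 + Poly_Mapping.single (U 0) (d - 2)
     else Poly_Mapping.single (V 0) 1 + Poly_Mapping.single (U 1) (d - 2))"

text \<open>This makes the off-diagonal entries zero. If \<open>j < d\<close>, the column has no
  \<open>V\<close>, so the row must supply \<open>V l\<close>, and the exponent of
  \<open>U 0\<close> forces \<open>l = j\<close>. The last two columns already contain a
  \<open>V\<close>, which fixes \<open>l\<close> as \<open>d - 1\<close> or \<open>0\<close>; the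
  exponents then force the row \<open>U 0\<close> or \<open>U 1\<close> respectively.\<close>

lemma G_column_add_row_eq_monomial:
  assumes d: "d \<ge> 2" and ij: "i < d + 2" "j < d + 2" and l: "l < d"
    and eq: "G_column d j + Poly_Mapping.single (G_row d i) 1 = G_monomial d l"
  shows "i = j"
proof -
  have eq': "Poly_Mapping.lookup (G_column d j) x + (if G_row d i = x then 1 else 0) =
      (case x of V j \<Rightarrow> if l = j then 1 else 0 | U j \<Rightarrow> if j = 0 then l else if j = 1 then d - 1 - l else 0)"
    for x
    using arg_cong[OF eq, of "\<lambda>m. Poly_Mapping.lookup m x"]
    by (cases "G_row d i = x") (simp_all add: lookup_add lookup_single lookup_G_monomial)
  consider "j < d" | "j = d" | "j = d + 1" using ij by linarith
  then show ?thesis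
  proof cases
    case 1
    then show ?thesis
      using eq'[of "V l"] eq'[of "U 0"]
      by (auto simp: G_column_def G_row_def lookup_add lookup_single when_def split: if_splits)
  next
    case 2
    have "l = d - 1"
      using eq'[of "V (d - 1)"] 2
      by (auto simp: G_column_def lookup_add lookup_single when_def split: if_splits)
    then show ?thesis
      using eq'[of "V (d - 1)"] eq'[of "V i"] eq'[of "U 0"] 2 d ij
      by (auto simp: G_column_def G_row_def lookup_add lookup_single when_def split: if_splits)
  next
    case 3
    have "l = 0"
      using eq'[of "V 0"] 3
      by (auto simp: G_column_def lookup_add lookup_single when_def split: if_splits)
    then show ?thesis
      using eq'[of "V 0"] eq'[of "V i"] eq'[of "U 0"] 3 d ij
      by (auto simp: G_column_def G_row_def lookup_add lookup_single when_def split: if_splits)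
  qed
qed

lemma G_column_add_row_diagonal:
  assumes d: "d \<ge> 2" and i: "i < d + 2"
  shows "\<exists>l<d. G_column d i + Poly_Mapping.single (G_row d i) 1 = G_monomial d l"
proof -
  consider "i < d" | "i = d" | "i = d + 1" using i by linarith
  then show ?thesis
  proof cases
    case 1
    then show ?thesis
      by (intro exI[of _ i]) (simp add: G_column_def G_row_def G_monomial_def add_ac)
  next
    case 2
    \<comment> \<open>Here \<open>d \<ge> 2\<close> keeps the truncated subtraction honest; the term
      hit is the last one, in which \<open>U 1\<close> has exponent 0.\<close>
    have "Poly_Mapping.single (U 0) (d - 2) + Poly_Mapping.single (U 0) 1 = Poly_Mapping.single (U 0) (d - 1)"
      using d by (subst single_add[symmetric]) (rule arg_cong, simp)
    then show ?thesis
      using d 2 by (intro exI[of _ "d - 1"]) (simp add: G_column_def G_row_def G_monomial_def add.assoc)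
  next
    case 3
    have "Poly_Mapping.single (U 1) (d - 2) + Poly_Mapping.single (U 1) 1 = Poly_Mapping.single (U 1) (d - 1)"
      using d by (subst single_add[symmetric]) (rule arg_cong, simp)
    then show ?thesis
      using d 3 by (intro exI[of _ 0]) (simp add: G_column_def G_row_def G_monomial_def add.assoc)
  qed
qed

lemma G_column_in_monomials:
  assumes d: "d \<ge> 2" and j: "j < d + 2"
  shows "G_column d j \<in> monomials (G_vars d) (d - 1)"
proof -
  have vars: "U 0 \<in> G_vars d" "U 1 \<in> G_vars d" "i < d \<Longrightarrow> V i \<in> G_vars d" for i
    by (auto simp: G_vars_def)
  have two: "Poly_Mapping.single x a + Poly_Mapping.single y b \<in> monomials (G_vars d) (d - 1)"
    if "x \<in> G_vars d" "y \<in> G_vars d" "a + b = d - 1" for x y a b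
    using monomials_add[OF single_in_monomials[OF that(1)] single_in_monomials[OF that(2)], of a b]
    by (simp add: that(3))
  show ?thesis
    unfolding G_column_def using d j by (auto intro!: two vars simp del: One_nat_def)
qed

text \<open>The matrix is diagonal, and a diagonal entry is a positive integer times a coefficient 1
  of \<open>G d\<close>, hence nonzero over the complex numbers. Triangularity is enough to read off
  the determinant.\<close>

lemma det_catalecticant_G_nonzero:
  assumes d: "d \<ge> 2"
  shows "det (catalecticant (d + 2) (G_row d) (G_column d) (G d)) \<noteq> 0"
proof -
  let ?C = "catalecticant (d + 2) (G_row d) (G_column d) (G d)"
  have C: "?C \<in> carrier_mat (d + 2) (d + 2)"
    by (simp add: catalecticant_def)
  have entry: "?C $$ (i, j) \<noteq> 0 \<longleftrightarrow> i = j" if "i < d + 2" "j < d + 2" for i j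
  proof -
    have "?C $$ (i, j) = of_nat (Poly_Mapping.lookup (G_column d j) (G_row d i) + 1) *
        Poly_Mapping.lookup (G d) (G_column d j + Poly_Mapping.single (G_row d i) 1)"
      using that by (simp add: catalecticant_def lookup_pdiff)
    then show ?thesis
      unfolding lookup_G
      using G_column_add_row_eq_monomial[OF d that] G_column_add_row_diagonal[OF d, of i] that
      by (auto simp del: of_nat_add of_nat_Suc)
  qed
  have "upper_triangular ?C"
  proof (rule upper_triangularI)
    fix i j assume "j < i" "i < dim_row ?C"
    then show "?C $$ (i, j) = 0"
      using entry[of i j] C by simp
  qed
  then have "det ?C = prod_list (diag_mat ?C)"
    by (rule det_upper_triangular) (rule C)
  also have "\<dots> \<noteq> 0"
  proof -
    have "?C $$ (i, i) \<noteq> 0" if "i < d + 2" for i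
      using entry[of i i] that by simp
    then show ?thesis
      using C by (auto simp: diag_mat_def prod_list_zero_iff simp del: upt_Suc)
  qed
  finally show ?thesis .
qed

theorem lemma6p1:
  fixes d :: nat
  assumes "d \<ge> 3"
  shows "border_rank (G_vars d) d (G d) = d + 2"
  unfolding border_rank_def
proof (rule Least_equality)
  show "proj_pt (G d) \<in> secant_variety (G_vars d) d (d + 2)"
    using assms by (intro G_in_secant_variety) simp
next
  fix r assume r: "proj_pt (G d) \<in> secant_variety (G_vars d) d r"
  show "d + 2 \<le> r"
  proof (rule ccontr)
    assume "\<not> d + 2 \<le> r"
    moreover have "G_row d i \<in> G_vars d" if "i < d + 2" for i
    proof -
      have "i < d \<or> i = d \<or> i = d + 1" using that by linarith
      then show ?thesis by (auto simp: G_row_def G_vars_def)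
    qed
    ultimately have "det (catalecticant (d + 2) (G_row d) (G_column d) (G d)) = 0"
      using assms
      by (intro catalecticant_vanishes_on_secant[OF r] G_column_in_monomials) simp_all
    then show False
      using det_catalecticant_G_nonzero assms by simp
  qed
qed

end
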